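(* (1) Let $C_1,C_2\subseteq\mathbb{F}_q^n$ be linear codes (with the Hamming metric) such that $C_2$ is an $\mathbb{F}_q$-subspace of $C_1$, and let $M_1,M_2$ be the matroids of generator matrices of $C_1,C_2$, respectively. Then $Id:M_1\to M_2$ is a strong map of matroids. (2) Let $C_1,C_2\subseteq\mathbb{F}_{q^m}^n$ be $\mathbb{F}_{q^m}$-linear rank-metric codes such that $C_2$ is an $\mathbb{F}_{q^m}$-subspace of $C_1$, and let $\mathcal{M}_1,\mathcal{M}_2$ be the $q$-matroids of generator matrices of $C_1,C_2$, respectively. Then $Id:\mathcal{M}_1\to\mathcal{M}_2$ is a strong map of $q$-matroids.
   Context: Hamming case: for a linear code $C\subseteq\mathbb{F}_q^n$, the matroid of a generator matrix of $C$ has ground set $E=\{1,\dots,n\}$ (the columns) and rank function $r(X)=\dim_{\mathbb{F}_q} C-\dim_{\mathbb{F}_q} C(E\setminus X)$ for $X\subseteq E$, where $C(J)=\{c\in C:\ \text{the support of } c \text{ is contained in } J\}$ (this equals the rank of the columns indexed by $X$). For matroids $M_1,M_2$ on the same ground set, $Id:M_1\to M_2$ is a strong map if every flat of $M_2$ is a flat of $M_1$. Rank-metric case: let $E=\mathbb{F}_q^n$. The support of $c\in\mathbb{F}_{q^m}^n$ is the subspace of $\mathbb{F}_q^n$ given by the row space of the $m\times n$ matrix over $\mathbb{F}_q$ obtained by expanding each coordinate of $c$ as a column in a fixed $\mathbb{F}_q$-basis of $\mathbb{F}_{q^m}$. For an $\mathbb{F}_{q^m}$-linear code $C\subseteq\mathbb{F}_{q^m}^n$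 and a subspace $J\subseteq E$, let $C(J)$ be the set of codewords of $C$ with support contained in $J$. The $q$-matroid of (a generator matrix of) $C$ is $(E,\rho)$ with $\rho(X)=\dim_{\mathbb{F}_{q^m}}C-\dim_{\mathbb{F}_{q^m}}C(X^\perp)$ for subspaces $X\subseteq E$, with $\perp$ the orthogonal complement for the standard inner product on $\mathbb{F}_q^n$. A $q$-matroid on $E$ is a pair $(E,\rho)$ with $\rho$ integer-valued on subspaces such that $0\le\rho(A)\le\dim A$; $\rho(A)\le\rho(B)$ whenever $A\subseteq B$; and $\rho(A+B)+\rho(A\cap B)\le\rho(A)+\rho(B)$ for all subspaces $A,B$. A subspace $A$ is a flat if $\rho(A+x)>\rho(A)$ for every $1$-dimensional $x\not\subseteq A$. For $q$-matroids $\mathcal{M}_1,\mathcal{M}_2$ on $E$, $Id:\mathcal{M}_1\to\mathcal{M}_2$ is a strong map if every flat of $\mathcal{M}_2$ is a flat of $\mathcal{M}_1$. *)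

theory Defs
  imports "HOL-Analysis.Analysis" "HOL-Library.Set_Algebras"
begin

section \<open>Matroids and \<open>q\<close>-matroids\<close>

text \<open>
  The ground set of a matroid is the whole finite type \<open>'e\<close>, and a matroid is identified with its
  rank function.  Likewise the ground space of a \<open>q\<close>-matroid is the whole space \<open>'a ^ 'n\<close>; its rank
  function is only ever inspected on subspaces.  Hence two matroids (\<open>q\<close>-matroids) of the same type
  have the same ground set (space), and \<open>Id\<close> denotes the identity of that ground set (space).
\<close>

definition matroid :: "('e::finite set \<Rightarrow> int) \<Rightarrow> bool" where
  "matroid r \<longleftrightarrow>
     (\<forall>X. 0 \<le> r X \<and> r X \<le> int (card X)) \<and>
     (\<forall>X Y. X \<subseteq> Y \<longrightarrow> r X \<le> r Y) \<and>
     (\<forall>X Y. r (X \<union> Y) + r (X \<inter> Y) \<le> r X + r Y)"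

definition flat :: "('e::finite set \<Rightarrow> int) \<Rightarrow> 'e set \<Rightarrow> bool" where
  "flat r F \<longleftrightarrow> (\<forall>x. x \<notin> F \<longrightarrow> r F < r (insert x F))"

definition strong_map_Id :: "('e::finite set \<Rightarrow> int) \<Rightarrow> ('e set \<Rightarrow> int) \<Rightarrow> bool" where
  "strong_map_Id r\<^sub>1 r\<^sub>2 \<longleftrightarrow> matroid r\<^sub>1 \<and> matroid r\<^sub>2 \<and> (\<forall>F. flat r\<^sub>2 F \<longrightarrow> flat r\<^sub>1 F)"

text \<open>The sum \<open>A + B\<close> of two subspaces is the elementwise sum of sets.\<close>

definition q_matroid :: "(('a::{field,finite} ^ 'n::finite) set \<Rightarrow> int) \<Rightarrow> bool" where
  "q_matroid \<rho> \<longleftrightarrow>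
     (\<forall>A. vec.subspace A \<longrightarrow> 0 \<le> \<rho> A \<and> \<rho> A \<le> int (vec.dim A)) \<and>
     (\<forall>A B. vec.subspace A \<longrightarrow> vec.subspace B \<longrightarrow> A \<subseteq> B \<longrightarrow> \<rho> A \<le> \<rho> B) \<and>
     (\<forall>A B. vec.subspace A \<longrightarrow> vec.subspace B \<longrightarrow>
        \<rho> (A + B) + \<rho> (A \<inter> B) \<le> \<rho> A + \<rho> B)"

definition q_flat ::
    "(('a::{field,finite} ^ 'n::finite) set \<Rightarrow> int) \<Rightarrow> ('a ^ 'n) set \<Rightarrow> bool" where
  "q_flat \<rho> A \<longleftrightarrow> vec.subspace A \<and>
     (\<forall>X. vec.subspace X \<longrightarrow> vec.dim X = 1 \<longrightarrow> \<not> X \<subseteq> A \<longrightarrow> \<rho> A < \<rho> (A + X))"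

definition q_strong_map_Id ::
    "(('a::{field,finite} ^ 'n::finite) set \<Rightarrow> int) \<Rightarrow> (('a ^ 'n) set \<Rightarrow> int) \<Rightarrow> bool" where
  "q_strong_map_Id \<rho>\<^sub>1 \<rho>\<^sub>2 \<longleftrightarrow>
     q_matroid \<rho>\<^sub>1 \<and> q_matroid \<rho>\<^sub>2 \<and> (\<forall>A. q_flat \<rho>\<^sub>2 A \<longrightarrow> q_flat \<rho>\<^sub>1 A)"


section \<open>Codes in the Hamming metric\<close>

definition hamming_support :: "'a::{field,finite} ^ 'n::finite \<Rightarrow> 'n set" where
  "hamming_support c = {i. c $ i \<noteq> 0}"

definition hamming_subcode ::
    "('a::{field,finite} ^ 'n::finite) set \<Rightarrow> 'n set \<Rightarrow> ('a ^ 'n) set" where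
  "hamming_subcode C J = {c \<in> C. hamming_support c \<subseteq> J}"

definition hamming_matroid :: "('a::{field,finite} ^ 'n::finite) set \<Rightarrow> 'n set \<Rightarrow> int" where
  "hamming_matroid C X = int (vec.dim C) - int (vec.dim (hamming_subcode C (UNIV - X)))"


section \<open>Codes in the rank metric\<close>

text \<open>
  The extension \<open>\<F>\<^bsub>q^m\<^esub> / \<F>\<^sub>q\<close> is given by finite fields \<open>'b\<close> and \<open>'a\<close> and a ring homomorphism
  \<open>emb :: 'a \<Rightarrow> 'b\<close> (necessarily injective), which makes \<open>'b\<close> a vector space over \<open>'a\<close>.
\<close>

locale finite_field_extension =
  fixes emb :: "'a::{field,finite} \<Rightarrow> 'b::{field,finite}"
  assumes emb_1: "emb 1 = 1"
    and emb_add: "emb (x + y) = emb x + emb y"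
    and emb_mult: "emb (x * y) = emb x * emb y"
begin

sublocale ext: vector_space "\<lambda>a x. emb a * x"
  by unfold_locales (simp_all add: emb_1 emb_add emb_mult algebra_simps)

end

text \<open>
  A basis indexed by the finite type \<open>'m\<close>; its existence forces the degree \<open>m\<close> of the
  extension to be \<open>CARD('m)\<close>.
\<close>

locale finite_field_extension_basis = finite_field_extension emb
  for emb :: "'a::{field,finite} \<Rightarrow> 'b::{field,finite}" +
  fixes \<beta> :: "'m::finite \<Rightarrow> 'b"
  assumes inj_basis: "inj \<beta>"
    and independent_basis: "ext.independent (range \<beta>)"
    and span_basis: "ext.span (range \<beta>) = UNIV"
begin

text \<open>Column \<open>j\<close> of the \<open>m \<times> n\<close> matrix \<open>expand c\<close> holds the coordinates of \<open>c $ j\<close>.\<close>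

definition expand :: "'b ^ 'n::finite \<Rightarrow> 'a ^ 'n ^ 'm" where
  "expand c = (\<chi> i j. ext.representation (range \<beta>) (c $ j) (\<beta> i))"

definition rank_support :: "'b ^ 'n::finite \<Rightarrow> ('a ^ 'n) set" where
  "rank_support c = vec.span (rows (expand c))"

definition rank_subcode :: "('b ^ 'n::finite) set \<Rightarrow> ('a ^ 'n) set \<Rightarrow> ('b ^ 'n) set" where
  "rank_subcode C J = {c \<in> C. rank_support c \<subseteq> J}"

end

definition orth_compl :: "('a::{field,finite} ^ 'n::finite) set \<Rightarrow> ('a ^ 'n) set" where
  "orth_compl X = {y. \<forall>x\<in>X. scalar_product x y = 0}"

context finite_field_extension_basis
begin

text \<open>Dimensions of codes are over the large field \<open>'b\<close>.\<close>

definition rank_q_matroid :: "('b ^ 'n::finite) set \<Rightarrow> ('a ^ 'n) set \<Rightarrow> int" where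
  "rank_q_matroid C X = int (vec.dim C) - int (vec.dim (rank_subcode C (orth_compl X)))"

end

end

theory Submission
  imports Defs
begin

text \<open>
  The Hamming and the rank-metric rank functions have the same shape.  Attach to a set \<open>V\<close> of
  vectors over the field of the code the number \<open>dim C - dim (C \<inter> V\<^sup>\<bottom>)\<close>.  The matroid is
  obtained by sending a coordinate to its unit vector, and the \<open>q\<close>-matroid by extending scalars
  from the small to the large field.  If the number for \<open>C\<^sub>2\<close> grows from \<open>V\<close> to \<open>W \<supseteq> V\<close>, then some
  codeword of \<open>C\<^sub>2\<close> lies in \<open>V\<^sup>\<bottom>\<close> but not in \<open>W\<^sup>\<bottom>\<close>.  It is also a codeword of \<open>C\<^sub>1\<close>, so the
  number for \<open>C\<^sub>1\<close> grows as well.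
\<close>

definition code_rank :: "('a::{field,finite} ^ 'n::finite) set \<Rightarrow> ('a ^ 'n) set \<Rightarrow> int" where
  "code_rank C V = int (vec.dim C) - int (vec.dim (C \<inter> orth_compl V))"

section \<open>Rank axioms for \<open>code_rank\<close>\<close>

lemma subspace_orth_compl: "vec.subspace (orth_compl V)"
  by (auto simp: vec.subspace_def orth_compl_def scalar_product_def algebra_simps sum.distrib
      simp flip: sum_distrib_left)

lemma orth_compl_Un: "orth_compl (V \<union> W) = orth_compl V \<inter> orth_compl W"
  by (auto simp: orth_compl_def)

lemma orth_compl_anti_mono: "V \<subseteq> W \<Longrightarrow> orth_compl W \<subseteq> orth_compl V"
  by (auto simp: orth_compl_def)

lemma code_rank_nonneg: "0 \<le> code_rank C V"
  unfolding code_rank_def by (simp add: vec.dim_subset)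

lemma code_rank_mono: "V \<subseteq> W \<Longrightarrow> code_rank C V \<le> code_rank C W"
  unfolding code_rank_def
  by (intro diff_left_mono of_nat_mono vec.dim_subset Int_mono orth_compl_anti_mono order_refl)

text \<open>One linear equation lowers the dimension by at most one: a codeword \<open>d\<close>
  violating it spans \<open>C\<close> together with the solutions.\<close>

lemma dim_le_dim_Int_orth_compl_singleton:
  fixes C :: "('a::{field,finite} ^ 'n::finite) set"
  assumes C: "vec.subspace C"
  shows "vec.dim C \<le> vec.dim (C \<inter> orth_compl {v}) + 1"
proof (cases "C \<subseteq> orth_compl {v}")
  case True
  then show ?thesis by (simp add: Int_absorb2)
next
  case False
  then obtain d where d: "d \<in> C" "scalar_product v d \<noteq> 0"
    by (auto simp: orth_compl_def)
  have "c \<in> vec.span (insert d (C \<inter> orth_compl {v}))" if "c \<in> C" for c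
  proof -
    \<comment> \<open>This multiple of \<open>d\<close> is the one whose removal makes
      \<open>c\<close> orthogonal to \<open>v\<close>.\<close>
    define k where "k = scalar_product v c / scalar_product v d"
    have "scalar_product v (c - k *s d) = scalar_product v c - k * scalar_product v d"
      by (simp add: scalar_product_def algebra_simps sum_subtractf sum_distrib_left)
    then have "c - k *s d \<in> C \<inter> orth_compl {v}"
      using C d that by (simp add: orth_compl_def k_def vec.subspace_diff vec.subspace_scale)
    then show ?thesis
      using vec.span_base unfolding vec.span_insert by blast
  qed
  then have "vec.dim C \<le> vec.dim (insert d (C \<inter> orth_compl {v}))"
    by (metis subsetI vec.dim_mono)
  then show ?thesis
    by (auto simp: vec.dim_insert split: if_splits)
qed

text \<open>Induction on \<open>V\<close>: each further vector imposes one further equation on the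
  code.\<close>

lemma code_rank_le_card:
  fixes C :: "('a::{field,finite} ^ 'n::finite) set"
  assumes C: "vec.subspace C"
  shows "code_rank C V \<le> int (card V)"
proof -
  have "finite V" by simp
  then have "vec.dim C \<le> vec.dim (C \<inter> orth_compl V) + card V"
  proof (induction V)
    case empty
    then show ?case by (simp add: orth_compl_def)
  next
    case (insert v V)
    have "vec.subspace (C \<inter> orth_compl V)"
      by (intro vec.subspace_inter C subspace_orth_compl)
    moreover have "C \<inter> orth_compl (insert v V) = C \<inter> orth_compl V \<inter> orth_compl {v}"
      by (auto simp: orth_compl_def)
    ultimately show ?case
      using dim_le_dim_Int_orth_compl_singleton[of "C \<inter> orth_compl V" v] insert by simp
  qed
  then show ?thesis
    unfolding code_rank_def by linarith
qed

text \<open>The dimension formula for \<open>S + T\<close>, which is contained in the part of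
  \<open>C\<close> orthogonal to \<open>U\<close>. The set \<open>U\<close> stands for the image of
  an intersection; asking only for inclusions avoids an argument about injectivity.\<close>

lemma code_rank_submodular:
  fixes C :: "('a::{field,finite} ^ 'n::finite) set"
  assumes C: "vec.subspace C" and "U \<subseteq> V" "U \<subseteq> W"
  shows "code_rank C (V \<union> W) + code_rank C U \<le> code_rank C V + code_rank C W"
proof -
  define S T where "S = C \<inter> orth_compl V" and "T = C \<inter> orth_compl W"
  have ST: "vec.subspace S" "vec.subspace T"
    unfolding S_def T_def by (intro vec.subspace_inter C subspace_orth_compl)+
  have "vec.subspace (C \<inter> orth_compl U)"
    by (intro vec.subspace_inter C subspace_orth_compl)
  moreover have "S \<subseteq> C \<inter> orth_compl U" "T \<subseteq> C \<inter> orth_compl U"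
    unfolding S_def T_def using assms by (intro Int_mono orth_compl_anti_mono; simp)+
  ultimately have "{x + y |x y. x \<in> S \<and> y \<in> T} \<subseteq> C \<inter> orth_compl U"
    using vec.subspace_add by blast
  then have "vec.dim {x + y |x y. x \<in> S \<and> y \<in> T} \<le> vec.dim (C \<inter> orth_compl U)"
    by (rule vec.dim_subset)
  moreover have "S \<inter> T = C \<inter> orth_compl (V \<union> W)"
    by (auto simp: S_def T_def orth_compl_Un)
  ultimately show ?thesis
    using vec.dim_sums_Int[OF ST] by (simp add: code_rank_def S_def T_def)
qed

lemma code_rank_less_mono:
  fixes C\<^sub>1 C\<^sub>2 :: "('a::{field,finite} ^ 'n::finite) set"
  assumes C: "vec.subspace C\<^sub>1" "C\<^sub>2 \<subseteq> C\<^sub>1"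
    and "V \<subseteq> W" "code_rank C\<^sub>2 V < code_rank C\<^sub>2 W"
  shows "code_rank C\<^sub>1 V < code_rank C\<^sub>1 W"
proof -
  have "C\<^sub>2 \<inter> orth_compl V \<noteq> C\<^sub>2 \<inter> orth_compl W"
    using assms(4) by (auto simp: code_rank_def)
  \<comment> \<open>A codeword of \<open>C\<^sub>2\<close> that separates the two complements also
    lies in \<open>C\<^sub>1\<close> and makes the inclusion strict.\<close>
  then have "C\<^sub>1 \<inter> orth_compl W \<subset> C\<^sub>1 \<inter> orth_compl V"
    using orth_compl_anti_mono[OF \<open>V \<subseteq> W\<close>] C(2) by blast
  then have "vec.dim (C\<^sub>1 \<inter> orth_compl W) < vec.dim (C\<^sub>1 \<inter> orth_compl V)"
    by (metis vec.dim_psubset vec.span_eq_iff vec.subspace_inter C(1) subspace_orth_compl)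
  then show ?thesis
    by (simp add: code_rank_def)
qed

section \<open>The Hamming metric\<close>

text \<open>Pairing with a unit vector reads off a coordinate, so avoiding \<open>X\<close> in the
  support is orthogonality to its unit vectors.\<close>

lemma hamming_matroid_eq_code_rank:
  fixes C :: "('a::{field,finite} ^ 'n::finite) set"
  shows "hamming_matroid C X = code_rank C ((\<lambda>i. axis i 1) ` X)"
proof -
  have "scalar_product (axis i 1) c = c $ i" for i and c :: "'a ^ 'n"
    by (simp add: scalar_product_def axis_def if_distrib[of "\<lambda>x. x * _"] cong: if_cong)
  then have "hamming_subcode C (UNIV - X) = C \<inter> orth_compl ((\<lambda>i. axis i 1) ` X)"
    by (auto simp: hamming_subcode_def hamming_support_def orth_compl_def)
  then show ?thesis
    by (simp add: hamming_matroid_def code_rank_def)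
qed

lemma matroid_hamming_matroid:
  assumes "vec.subspace C"
  shows "matroid (hamming_matroid C)"
proof -
  have "code_rank C ((\<lambda>i. axis i 1) ` X) \<le> int (card X)" for X
    by (rule order_trans[OF code_rank_le_card[OF assms]]) (simp add: card_image_le)
  then show ?thesis
    unfolding matroid_def hamming_matroid_eq_code_rank image_Un
    by (auto intro!: code_rank_nonneg code_rank_mono code_rank_submodular assms)
qed

text \<open>Flatness is strict growth of rank under every proper one-element enlargement, and growth
  passes from \<open>C\<^sub>2\<close> to \<open>C\<^sub>1\<close>.\<close>

lemma strong_map_Id_hamming_matroid:
  assumes "vec.subspace C\<^sub>1" "vec.subspace C\<^sub>2" "C\<^sub>2 \<subseteq> C\<^sub>1"
  shows "strong_map_Id (hamming_matroid C\<^sub>1) (hamming_matroid C\<^sub>2)"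
proof -
  have "hamming_matroid C\<^sub>1 F < hamming_matroid C\<^sub>1 (insert x F)"
    if "hamming_matroid C\<^sub>2 F < hamming_matroid C\<^sub>2 (insert x F)" for F x
    using that unfolding hamming_matroid_eq_code_rank
    by (rule code_rank_less_mono[OF assms(1,3) image_mono[OF subset_insertI]])
  then show ?thesis
    using assms by (simp add: strong_map_Id_def matroid_hamming_matroid flat_def)
qed

section \<open>The rank metric\<close>

context finite_field_extension_basis
begin

text \<open>Moves vectors over the small field to the space of the code, where orthogonality to
  codewords makes sense.\<close>

definition extend_scalars :: "'a ^ 'n::finite \<Rightarrow> 'b ^ 'n" where
  "extend_scalars x = (\<chi> j. emb (x $ j))"

lemma emb_0: "emb 0 = 0"
  by (metis add_0 add_cancel_left_left emb_add)

lemma extend_scalars_0: "extend_scalars 0 = 0"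
  by (simp add: extend_scalars_def emb_0 vec_eq_iff)

lemma extend_scalars_add: "extend_scalars (x + y) = extend_scalars x + extend_scalars y"
  by (simp add: extend_scalars_def emb_add vec_eq_iff)

lemma extend_scalars_scale: "extend_scalars (k *s x) = emb k *s extend_scalars x"
  by (simp add: extend_scalars_def emb_mult vec_eq_iff)

text \<open>For fixed \<open>c\<close>, the vectors whose extension is orthogonal to
  \<open>c\<close> form a subspace over the small field, so checking generators suffices.\<close>

lemma orth_compl_extend_scalars_span:
  "orth_compl (extend_scalars ` vec.span B) = orth_compl (extend_scalars ` B)"
proof
  show "orth_compl (extend_scalars ` vec.span B) \<subseteq> orth_compl (extend_scalars ` B)"
    by (intro orth_compl_anti_mono image_mono vec.span_superset)
  show "orth_compl (extend_scalars ` B) \<subseteq> orth_compl (extend_scalars ` vec.span B)"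
  proof
    fix c assume c: "c \<in> orth_compl (extend_scalars ` B)"
    have "vec.subspace {x. scalar_product (extend_scalars x) c = 0}"
      by (auto simp: vec.subspace_def extend_scalars_0 extend_scalars_add extend_scalars_scale
          scalar_product_def algebra_simps sum.distrib simp flip: sum_distrib_left)
    then have "vec.span B \<subseteq> {x. scalar_product (extend_scalars x) c = 0}"
      using c by (intro vec.span_minimal) (auto simp: orth_compl_def)
    then show "c \<in> orth_compl (extend_scalars ` vec.span B)"
      by (auto simp: orth_compl_def)
  qed
qed

text \<open>Pairing \<open>x\<close> with the rows of \<open>expand c\<close> yields the
  coordinates, in the basis \<open>\<beta>\<close>, of the pairing of
  \<open>extend_scalars x\<close> with \<open>c\<close>; all vanish exactly when that pairing
  does.\<close>

lemma rank_support_subset_orth_compl_iff: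
  "rank_support c \<subseteq> orth_compl X \<longleftrightarrow> c \<in> orth_compl (extend_scalars ` X)"
proof -
  let ?rep = "ext.representation (range \<beta>)"
  \<comment> \<open>Coordinates are linear over the small field, which contains the entries of
    \<open>x\<close>.\<close>
  have eq: "scalar_product x (row i (expand c)) = ?rep (scalar_product (extend_scalars x) c) (\<beta> i)"
    for x i
    using independent_basis span_basis
    by (simp add: scalar_product_def extend_scalars_def row_def expand_def
        ext.representation_sum ext.representation_scale)
  have rep_0: "(\<forall>i. ?rep z (\<beta> i) = 0) \<longleftrightarrow> z = 0" for z
  proof
    assume "\<forall>i. ?rep z (\<beta> i) = 0"
    \<comment> \<open>Off the basis, \<open>representation\<close> is zero by convention.\<close>
    then have "?rep z b = 0" for b
      using ext.representation_ne_zero[of "range \<beta>" z b] by auto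
    moreover have "(\<Sum>b | ?rep z b \<noteq> 0. emb (?rep z b) * b) = z"
      using independent_basis span_basis by (intro ext.sum_nonzero_representation_eq) auto
    ultimately show "z = 0" by simp
  qed (simp add: ext.representation_zero)
  have "rank_support c \<subseteq> orth_compl X \<longleftrightarrow> rows (expand c) \<subseteq> orth_compl X"
    unfolding rank_support_def using subspace_orth_compl vec.span_minimal vec.span_superset by blast
  also have "\<dots> \<longleftrightarrow> (\<forall>x\<in>X. \<forall>i. scalar_product x (row i (expand c)) = 0)"
    by (auto simp: rows_def orth_compl_def)
  also have "\<dots> \<longleftrightarrow> c \<in> orth_compl (extend_scalars ` X)"
    unfolding eq rep_0 by (simp add: orth_compl_def)
  finally show ?thesis .
qed

lemma rank_q_matroid_eq_code_rank: "rank_q_matroid C X = code_rank C (extend_scalars ` X)"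
proof -
  have "rank_subcode C (orth_compl X) = C \<inter> orth_compl (extend_scalars ` X)"
    by (auto simp: rank_subcode_def rank_support_subset_orth_compl_iff)
  then show ?thesis
    by (simp add: rank_q_matroid_def code_rank_def)
qed

text \<open>Allows a subspace to be replaced by a basis, and a sum of subspaces by their
  union.\<close>

lemma rank_q_matroid_span: "rank_q_matroid C (vec.span B) = rank_q_matroid C B"
  by (simp add: rank_q_matroid_eq_code_rank code_rank_def orth_compl_extend_scalars_span)

lemma rank_q_matroid_sum:
  assumes "vec.subspace A" "vec.subspace B"
  shows "rank_q_matroid C (A + B) = rank_q_matroid C (A \<union> B)"
proof -
  have "A + B = vec.span (A \<union> B)"
    unfolding vec.span_Un assms[THEN vec.span_eq_iff[THEN iffD2]] by (auto simp: set_plus_def)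
  then show ?thesis
    by (simp add: rank_q_matroid_span)
qed

lemma q_matroid_rank_q_matroid:
  fixes C :: "('b ^ 'n::finite) set"
  assumes C: "vec.subspace C"
  shows "q_matroid (rank_q_matroid C)"
  unfolding q_matroid_def
proof (intro conjI allI impI)
  fix A :: "('a ^ 'n) set"
  assume "vec.subspace A"
  show "0 \<le> rank_q_matroid C A"
    by (simp add: rank_q_matroid_eq_code_rank code_rank_nonneg)
  \<comment> \<open>Passing to a basis turns the bound by cardinality into one by dimension.\<close>
  obtain B where B: "B \<subseteq> A" "A \<subseteq> vec.span B" "card B = vec.dim A"
    using vec.basis_exists[of A] by metis
  then have "vec.span B = A"
    using \<open>vec.subspace A\<close> by (intro subset_antisym vec.span_minimal)
  then have "rank_q_matroid C A = code_rank C (extend_scalars ` B)"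
    by (metis rank_q_matroid_span rank_q_matroid_eq_code_rank)
  also have "\<dots> \<le> int (card (extend_scalars ` B))"
    by (rule code_rank_le_card[OF C])
  also have "\<dots> \<le> int (vec.dim A)"
    using B by (metis card_image_le finite of_nat_mono)
  finally show "rank_q_matroid C A \<le> int (vec.dim A)" .
next
  fix A B :: "('a ^ 'n) set"
  assume "A \<subseteq> B"
  then show "rank_q_matroid C A \<le> rank_q_matroid C B"
    by (simp add: rank_q_matroid_eq_code_rank code_rank_mono image_mono)
next
  fix A B :: "('a ^ 'n) set"
  assume "vec.subspace A" "vec.subspace B"
  then show "rank_q_matroid C (A + B) + rank_q_matroid C (A \<inter> B)
      \<le> rank_q_matroid C A + rank_q_matroid C B"
    unfolding rank_q_matroid_sum[OF \<open>vec.subspace A\<close> \<open>vec.subspace B\<close>]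
    unfolding rank_q_matroid_eq_code_rank image_Un
    by (intro code_rank_submodular C image_mono Int_lower1 Int_lower2)
qed

text \<open>As in the Hamming case, with \<open>A + X\<close> in place of \<open>insert x F\<close>;
  reading the sum as a union exhibits it as an enlargement of \<open>A\<close>.\<close>

lemma q_strong_map_Id_rank_q_matroid:
  assumes "vec.subspace D\<^sub>1" "vec.subspace D\<^sub>2" "D\<^sub>2 \<subseteq> D\<^sub>1"
  shows "q_strong_map_Id (rank_q_matroid D\<^sub>1) (rank_q_matroid D\<^sub>2)"
proof -
  have "rank_q_matroid D\<^sub>1 A < rank_q_matroid D\<^sub>1 (A + X)"
    if "vec.subspace A" "vec.subspace X" "rank_q_matroid D\<^sub>2 A < rank_q_matroid D\<^sub>2 (A + X)" for A X
    using that(3) unfolding rank_q_matroid_sum[OF that(1,2)]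
    unfolding rank_q_matroid_eq_code_rank
    by (rule code_rank_less_mono[OF assms(1,3) image_mono[OF Un_upper1]])
  then show ?thesis
    using assms by (simp add: q_strong_map_Id_def q_matroid_rank_q_matroid q_flat_def)
qed

end

theorem proposition5p2:
  fixes C\<^sub>1 C\<^sub>2 :: "('a::{field,finite} ^ 'n::finite) set"
    and emb :: "'k::{field,finite} \<Rightarrow> 'l::{field,finite}"
    and \<beta> :: "'m::finite \<Rightarrow> 'l"
    and D\<^sub>1 D\<^sub>2 :: "('l ^ 'p::finite) set"
  shows "(vec.subspace C\<^sub>1 \<and> vec.subspace C\<^sub>2 \<and> C\<^sub>2 \<subseteq> C\<^sub>1 \<longrightarrow>
           strong_map_Id (hamming_matroid C\<^sub>1) (hamming_matroid C\<^sub>2)) \<and>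
         (finite_field_extension_basis emb \<beta> \<and>
          vec.subspace D\<^sub>1 \<and> vec.subspace D\<^sub>2 \<and> D\<^sub>2 \<subseteq> D\<^sub>1 \<longrightarrow>
           q_strong_map_Id (finite_field_extension_basis.rank_q_matroid emb \<beta> D\<^sub>1)
                           (finite_field_extension_basis.rank_q_matroid emb \<beta> D\<^sub>2))"
  by (simp add: strong_map_Id_hamming_matroid
      finite_field_extension_basis.q_strong_map_Id_rank_q_matroid)

end
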